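(* Let $\mathcal{H}$ be a separable Hilbert space and let $I$ be an index set. For each $i \in I$ let $v_i > 0$ and let $\{f_{ij}\}_{j \in J_i}$ be a frame sequence in $\mathcal{H}$ with frame bounds $A_i$ and $B_i$. Define $W_i = \overline{\mathrm{span}}_{j\in J_i}\{f_{ij}\}$ for all $i\in I$ and choose an orthonormal basis $\{e_{ij}\}_{j \in K_i}$ for each subspace $W_i$. Suppose that $0 < A = \inf_{i \in I} A_i \le B = \sup_{i \in I} B_i < \infty$. Then the following conditions are equivalent. (1) $\{v_i f_{ij}\}_{i \in I,\, j \in J_i}$ is a frame for $\mathcal{H}$. (2) $\{v_i e_{ij}\}_{i \in I,\, j \in K_i}$ is a frame for $\mathcal{H}$. (3) $\{W_{i}\}_{i\in I}$ is a frame of subspaces with respect to $\{v_i\}_{i \in I}$ for $\mathcal{H}$.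
   Context: A family $\{f_k\}_{k\in K}$ in a Hilbert space $\mathcal{H}$ is a frame for $\mathcal{H}$ with (lower and upper) frame bounds $A,B$ if $0<A\le B<\infty$ and $A\|h\|^2 \le \sum_{k\in K} |\langle h,f_k\rangle|^2 \le B\|h\|^2$ for all $h\in\mathcal{H}$. A frame sequence is a family that is a frame for its closed linear span (with the corresponding frame bounds). For a closed subspace $W$, $\pi_W$ denotes the orthogonal projection of $\mathcal{H}$ onto $W$. Given weights $v_i>0$ ($i\in I$), a family $\{W_i\}_{i\in I}$ of closed subspaces of $\mathcal{H}$ is a frame of subspaces with respect to $\{v_i\}_{i\in I}$ for $\mathcal{H}$ if there are constants $0<C\le D<\infty$ such that $C\|f\|^2 \le \sum_{i\in I} v_i^2\|\pi_{W_i}(f)\|^2 \le D\|f\|^2$ for all $f\in\mathcal{H}$. *)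

theory Defs
  imports "HOL-Analysis.Analysis"
begin

text \<open>
  Scalars, treated uniformly over the real and the complex field. The class has both as instances
  (with trivial and with complex conjugation), and by the Gelfand-Mazur theorem there are no
  others up to isomorphism.
\<close>

class rc_scalar = real_normed_field +
  fixes kconj :: "'a \<Rightarrow> 'a"
  assumes kconj_add: "kconj (x + y) = kconj x + kconj y"
    and mult_kconj: "x * kconj x = (norm x)\<^sup>2 *\<^sub>R 1"

instantiation real :: rc_scalar
begin
definition kconj_real :: "real \<Rightarrow> real" where "kconj_real x = x"
instance by standard (simp_all add: kconj_real_def power2_eq_square)
end

instantiation complex :: rc_scalar
begin
definition kconj_complex :: "complex \<Rightarrow> complex" where "kconj_complex = cnj"
instance by standard (simp_all add: kconj_complex_def complex_norm_square [symmetric] scaleR_conv_of_real)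
end

text \<open>
  A Hilbert space is a Banach space over \<open>'k\<close> whose norm is induced by the inner product \<open>ip\<close>
  (linear in the first argument). The underlying real scaling of the type \<open>'a\<close> is the restriction
  of the scaling by \<open>'k\<close>.
\<close>

locale hilbert_space = vector_space smul
  for smul :: "'k::rc_scalar \<Rightarrow> 'a::banach \<Rightarrow> 'a" +
  fixes ip :: "'a \<Rightarrow> 'a \<Rightarrow> 'k"
  assumes smul_of_real: "smul (of_real r) x = r *\<^sub>R x"
    and ip_add_left: "ip (x + y) z = ip x z + ip y z"
    and ip_smul_left: "ip (smul c x) y = c * ip x y"
    and ip_commute: "ip y x = kconj (ip x y)"
    and ip_norm: "ip x x = of_real ((norm x)\<^sup>2)"

lemma hilbert_space_real:
  "hilbert_space scaleR (inner :: 'a::{real_inner,banach} \<Rightarrow> 'a \<Rightarrow> real)"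
  by unfold_locales
    (simp_all add: algebra_simps kconj_real_def inner_commute power2_norm_eq_inner)

lemma hilbert_space_complex:
  "hilbert_space (*) (\<lambda>x y :: complex. x * cnj y)"
  by unfold_locales
    (simp_all add: algebra_simps kconj_complex_def scaleR_conv_of_real
      complex_norm_square [symmetric])

definition closed_span :: "('k::rc_scalar \<Rightarrow> 'a::banach \<Rightarrow> 'a) \<Rightarrow> 'a set \<Rightarrow> 'a set" where
  "closed_span smul S = closure (module.span smul S)"

text \<open>
  Index sets are arbitrary, so sums of nonnegative terms are unordered sums; the \<open>summable_on\<close>
  conjuncts below say that these sums are finite (\<open>infsum\<close> is \<open>0\<close> on families that are not
  summable).
\<close>

definition frame_with_bounds ::
  "('a::banach \<Rightarrow> 'a \<Rightarrow> 'k::rc_scalar) \<Rightarrow> 'a set \<Rightarrow> 'b set \<Rightarrow> ('b \<Rightarrow> 'a) \<Rightarrow> real \<Rightarrow> real \<Rightarrow> bool" where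
  "frame_with_bounds ip W K g A B \<longleftrightarrow>
     0 < A \<and> A \<le> B \<and> g ` K \<subseteq> W \<and>
     (\<forall>h\<in>W. (\<lambda>k. (norm (ip h (g k)))\<^sup>2) summable_on K \<and>
        A * (norm h)\<^sup>2 \<le> (\<Sum>\<^sub>\<infinity>k\<in>K. (norm (ip h (g k)))\<^sup>2) \<and>
        (\<Sum>\<^sub>\<infinity>k\<in>K. (norm (ip h (g k)))\<^sup>2) \<le> B * (norm h)\<^sup>2)"

definition is_frame ::
  "('a::banach \<Rightarrow> 'a \<Rightarrow> 'k::rc_scalar) \<Rightarrow> 'b set \<Rightarrow> ('b \<Rightarrow> 'a) \<Rightarrow> bool" where
  "is_frame ip K g \<longleftrightarrow> (\<exists>A B. frame_with_bounds ip UNIV K g A B)"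

definition frame_sequence ::
  "('k::rc_scalar \<Rightarrow> 'a::banach \<Rightarrow> 'a) \<Rightarrow> ('a \<Rightarrow> 'a \<Rightarrow> 'k) \<Rightarrow> 'b set \<Rightarrow> ('b \<Rightarrow> 'a) \<Rightarrow> real \<Rightarrow> real \<Rightarrow> bool" where
  "frame_sequence smul ip K g A B \<longleftrightarrow>
     frame_with_bounds ip (closed_span smul (g ` K)) K g A B"

definition orthonormal_basis ::
  "('k::rc_scalar \<Rightarrow> 'a::banach \<Rightarrow> 'a) \<Rightarrow> ('a \<Rightarrow> 'a \<Rightarrow> 'k) \<Rightarrow> 'a set \<Rightarrow> 'b set \<Rightarrow> ('b \<Rightarrow> 'a) \<Rightarrow> bool" where
  "orthonormal_basis smul ip W K e \<longleftrightarrow>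
     (\<forall>j\<in>K. \<forall>k\<in>K. ip (e j) (e k) = (if j = k then 1 else 0)) \<and>
     closed_span smul (e ` K) = W"

text \<open>The orthogonal projection onto \<open>W\<close>; meaningful when \<open>W\<close> is a closed subspace.\<close>

definition orth_proj :: "('a::banach \<Rightarrow> 'a \<Rightarrow> 'k::rc_scalar) \<Rightarrow> 'a set \<Rightarrow> 'a \<Rightarrow> 'a" where
  "orth_proj ip W h = (THE p. p \<in> W \<and> (\<forall>w\<in>W. ip (h - p) w = 0))"

definition frame_of_subspaces ::
  "('k::rc_scalar \<Rightarrow> 'a::banach \<Rightarrow> 'a) \<Rightarrow> ('a \<Rightarrow> 'a \<Rightarrow> 'k) \<Rightarrow> 'i set \<Rightarrow> ('i \<Rightarrow> 'a set) \<Rightarrow> ('i \<Rightarrow> real) \<Rightarrow> bool" where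
  "frame_of_subspaces smul ip I W v \<longleftrightarrow>
     (\<forall>i\<in>I. 0 < v i \<and> module.subspace smul (W i) \<and> closed (W i)) \<and>
     (\<exists>C D. 0 < C \<and> C \<le> D \<and>
        (\<forall>h. (\<lambda>i. (v i)\<^sup>2 * (norm (orth_proj ip (W i) h))\<^sup>2) summable_on I \<and>
           C * (norm h)\<^sup>2 \<le> (\<Sum>\<^sub>\<infinity>i\<in>I. (v i)\<^sup>2 * (norm (orth_proj ip (W i) h))\<^sup>2) \<and>
           (\<Sum>\<^sub>\<infinity>i\<in>I. (v i)\<^sup>2 * (norm (orth_proj ip (W i) h))\<^sup>2) \<le> D * (norm h)\<^sup>2))"

end

theory Submission
  imports Defs
begin

text \<open>
  Everything is compared with the projections onto the \<open>W i\<close>. A vector of \<open>W i\<close> pairs with \<open>h\<close>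
  exactly as it pairs with the projection of \<open>h\<close> onto \<open>W i\<close>. Hence, if \<open>g i\<close> is a frame for \<open>W i\<close>
  with bounds between \<open>a > 0\<close> and \<open>b\<close>, then
  \<open>a * (v i)\<^sup>2 * \<parallel>\<pi>\<^sub>i h\<parallel>\<^sup>2 \<le> (\<Sum>j. \<bar>\<langle>h, v i g i j\<rangle>\<bar>\<^sup>2) \<le> b * (v i)\<^sup>2 * \<parallel>\<pi>\<^sub>i h\<parallel>\<^sup>2\<close>
  (lemma \<open>local_frame_projection_bounds\<close>). Summing over \<open>i\<close>, with all terms nonnegative, the sum
  over the glued family is finite exactly when the weighted sum of squared projections is, and the
  two differ by factors between \<open>a\<close> and \<open>b\<close>. So the glued family is a frame iff the \<open>W i\<close> form a
  frame of subspaces (lemma \<open>glued_frame_iff_frame_of_subspaces\<close>).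

  The theorem is this equivalence used twice: for the given frame sequences, where \<open>a\<close> and \<open>b\<close> are
  the infimum of the lower and the supremum of the upper bounds, and for the orthonormal bases,
  which by Parseval's identity (lemma \<open>orthonormal_basis_parseval_frame\<close>) are frames with both
  bounds \<open>1\<close>.

  The Hilbert space is given by an inner product over an abstract scalar field on a Banach space,
  so the projection theorem and Parseval's identity are derived from the inner product axioms.
\<close>

section \<open>Geometry of Hilbert spaces\<close>

context hilbert_space
begin

lemma kconj_0 [simp]: "kconj (0::'k) = 0"
  using kconj_add[of "0::'k" 0] by simp

lemma norm_kconj [simp]: "norm (kconj (c::'k)) = norm c"
proof (cases "c = 0")
  case False
  have "norm c * norm (kconj c) = norm (c * kconj c)"
    by (simp add: norm_mult)
  also have "\<dots> = norm c * norm c"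
    by (simp add: mult_kconj power2_eq_square)
  finally show ?thesis
    using False by simp
qed simp

lemma norm_ip_commute: "norm (ip x y) = norm (ip y x)"
  by (metis ip_commute norm_kconj)

lemma ip_eq_0_commute: "ip x y = 0 \<Longrightarrow> ip y x = 0"
  by (metis ip_commute kconj_0)

lemma ip_diff_left: "ip (x - y) z = ip x z - ip y z"
  using ip_add_left[of "x - y" y z] by simp

lemma ip_0_left [simp]: "ip 0 y = 0"
  using ip_diff_left[of 0 0 y] by simp

lemma ip_sum_left: "ip (sum u F) y = (\<Sum>k\<in>F. ip (u k) y)"
  by (induction F rule: infinite_finite_induct) (simp_all add: ip_add_left)

lemma ip_add_right: "ip x (y + z) = ip x y + ip x z"
  by (metis ip_add_left ip_commute kconj_add)

lemma ip_diff_right: "ip x (y - z) = ip x y - ip x z"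
  using ip_add_right[of x "y - z" z] by simp

lemma norm_ip_scaleR_right: "norm (ip x (r *\<^sub>R y)) = \<bar>r\<bar> * norm (ip x y)"
  by (metis ip_smul_left norm_ip_commute norm_mult norm_of_real smul_of_real)

text \<open>
  Homogeneity over the full scalar field follows from \<open>x * kconj x = \<bar>x\<bar>\<^sup>2\<close> at the scalar
  \<open>x = ip (c y) y = c * \<parallel>y\<parallel>\<^sup>2\<close>, since \<open>\<parallel>c y\<parallel>\<^sup>2 = ip (c y) (c y) = c * kconj (ip (c y) y)\<close>.
\<close>

lemma norm_smul: "norm (smul c y) = norm c * norm y"
proof (cases "y = 0")
  case False
  let ?n = "of_real ((norm y)\<^sup>2) :: 'k"
  have nz: "?n \<noteq> 0"
    using False by simp
  have "of_real ((norm (smul c y))\<^sup>2) * ?n = ip (smul c y) (smul c y) * ?n"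
    by (simp add: ip_norm)
  also have "\<dots> = (c * ?n) * kconj (c * ?n)"
    by (metis ip_commute ip_norm ip_smul_left mult.assoc mult.commute)
  also have "\<dots> = of_real ((norm (c * ?n))\<^sup>2)"
    by (simp add: mult_kconj of_real_def)
  also have "\<dots> = of_real ((norm c * norm y)\<^sup>2) * ?n"
    by (simp add: norm_mult norm_power power_mult_distrib power2_eq_square mult_ac)
  finally have "(of_real ((norm (smul c y))\<^sup>2) :: 'k) = of_real ((norm c * norm y)\<^sup>2)"
    using nz by simp
  then have "(norm (smul c y))\<^sup>2 = (norm c * norm y)\<^sup>2"
    unfolding of_real_eq_iff .
  then show ?thesis
    by simp
qed (metis mult_zero_right norm_zero scale_zero_right)

lemma norm_add_orthogonal:
  assumes "ip x y = 0"
  shows "(norm (x + y))\<^sup>2 = (norm x)\<^sup>2 + (norm y)\<^sup>2"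
proof -
  have "(of_real ((norm (x + y))\<^sup>2) :: 'k) = of_real ((norm x)\<^sup>2 + (norm y)\<^sup>2)"
    using assms ip_eq_0_commute[OF assms]
    by (simp add: ip_norm[symmetric] ip_add_left ip_add_right of_real_add del: of_real_power)
  then show ?thesis
    unfolding of_real_eq_iff .
qed

lemma parallelogram:
  fixes x y :: 'a
  shows "(norm (x + y))\<^sup>2 + (norm (x - y))\<^sup>2 = 2 * (norm x)\<^sup>2 + 2 * (norm y)\<^sup>2"
proof -
  have "(of_real ((norm (x + y))\<^sup>2 + (norm (x - y))\<^sup>2) :: 'k)
      = of_real (2 * (norm x)\<^sup>2 + 2 * (norm y)\<^sup>2)"
    by (simp only: of_real_add of_real_mult ip_norm[symmetric])
      (simp add: ip_diff_left ip_diff_right ip_add_left ip_add_right algebra_simps)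
  then show ?thesis
    unfolding of_real_eq_iff .
qed

text \<open>
  The vector subtracted from \<open>x\<close> is its projection onto the line through \<open>y\<close>; the exact gain in
  squared norm is what forces a nearest point to leave an orthogonal residual.
\<close>

lemma norm_diff_line_projection:
  assumes "y \<noteq> 0"
  shows "(norm (x - smul (ip x y / of_real ((norm y)\<^sup>2)) y))\<^sup>2
       = (norm x)\<^sup>2 - (norm (ip x y))\<^sup>2 / (norm y)\<^sup>2"
proof -
  define c where "c = ip x y / of_real ((norm y)\<^sup>2)"
  have "c * of_real ((norm y)\<^sup>2) = ip x y"
    using assms by (simp add: c_def)
  then have "ip (x - smul c y) y = 0"
    by (simp add: ip_diff_left ip_smul_left ip_norm)
  then have "ip (smul c y) (x - smul c y) = 0"
    by (simp add: ip_smul_left ip_eq_0_commute)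
  then have "ip (x - smul c y) (smul c y) = 0"
    by (rule ip_eq_0_commute)
  from norm_add_orthogonal[OF this]
  have "(norm x)\<^sup>2 = (norm (x - smul c y))\<^sup>2 + (norm c * norm y)\<^sup>2"
    by (simp add: norm_smul)
  moreover have "(norm c * norm y)\<^sup>2 = (norm (ip x y))\<^sup>2 / (norm y)\<^sup>2"
    using assms
    by (simp add: c_def norm_divide norm_power power_mult_distrib power2_eq_square norm_mult)
  ultimately show ?thesis
    unfolding c_def[symmetric] by simp
qed

lemma subspace_scaleR:
  assumes "subspace W" "w \<in> W"
  shows "r *\<^sub>R w \<in> W"
  using subspace_scale[OF assms, of "of_real r"] by (simp add: smul_of_real)

lemma subspace_closed_span: "subspace (closed_span smul S)"
  unfolding closed_span_def
proof (rule subspaceI)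
  show "0 \<in> closure (span S)"
    using span_zero closure_subset by blast
next
  fix x y assume "x \<in> closure (span S)" "y \<in> closure (span S)"
  then obtain a b where "\<And>n::nat. a n \<in> span S" "a \<longlonglongrightarrow> x" "\<And>n::nat. b n \<in> span S" "b \<longlonglongrightarrow> y"
    by (auto simp: closure_sequential)
  then have "\<And>n. a n + b n \<in> span S" "(\<lambda>n. a n + b n) \<longlonglongrightarrow> x + y"
    by (auto intro: span_add tendsto_add)
  then show "x + y \<in> closure (span S)"
    unfolding closure_sequential by (intro exI[of _ "\<lambda>n. a n + b n"]) simp
next
  fix c :: 'k and x assume "x \<in> closure (span S)"
  then obtain a where a: "\<And>n::nat. a n \<in> span S" "a \<longlonglongrightarrow> x"
    by (auto simp: closure_sequential)
  have "(\<lambda>n. norm c * norm (a n - x)) \<longlonglongrightarrow> norm c * 0"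
    by (intro tendsto_mult tendsto_const tendsto_norm_zero LIM_zero a(2))
  then have "(\<lambda>n. norm (smul c (a n) - smul c x)) \<longlonglongrightarrow> 0"
    by (simp add: norm_smul flip: scale_right_diff_distrib)
  then have "(\<lambda>n. smul c (a n)) \<longlonglongrightarrow> smul c x"
    using LIM_zero_cancel tendsto_norm_zero_iff by blast
  moreover have "\<And>n. smul c (a n) \<in> span S"
    using a(1) by (rule span_scale)
  ultimately show "smul c x \<in> closure (span S)"
    unfolding closure_sequential by (intro exI[of _ "\<lambda>n. smul c (a n)"]) simp
qed

lemma closed_closed_span: "closed (closed_span smul S)"
  by (simp add: closed_span_def)

text \<open>
  By the parallelogram law, points of \<open>W\<close> whose squared distance to \<open>h\<close> is within \<open>\<epsilon>\<close> of the
  infimum are within \<open>2 * sqrt \<epsilon>\<close> of each other, because their midpoint is again in \<open>W\<close>. So a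
  minimising sequence is Cauchy, and completeness supplies a minimiser.
\<close>

lemma nearest_point_exists:
  assumes W: "subspace W" "closed W"
  shows "\<exists>p\<in>W. \<forall>w\<in>W. (norm (h - p))\<^sup>2 \<le> (norm (h - w))\<^sup>2"
proof -
  define d where "d = (INF w\<in>W. (norm (h - w))\<^sup>2)"
  have ne: "(\<lambda>w. (norm (h - w))\<^sup>2) ` W \<noteq> {}"
    using subspace_0[OF W(1)] by blast
  have bdd: "bdd_below ((\<lambda>w. (norm (h - w))\<^sup>2) ` W)"
    by (rule bdd_belowI2[where m = 0]) simp
  have lower: "d \<le> (norm (h - w))\<^sup>2" if "w \<in> W" for w
    unfolding d_def by (rule cINF_lower[OF bdd that])
  have "\<exists>w\<in>W. (norm (h - w))\<^sup>2 < d + inverse (real (Suc n))" for n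
  proof -
    have "(INF w\<in>W. (norm (h - w))\<^sup>2) < d + inverse (real (Suc n))"
      unfolding d_def by simp
    then show ?thesis
      using cInf_lessD[OF ne] by fastforce
  qed
  then obtain s where s: "\<And>n. s n \<in> W" "\<And>n. (norm (h - s n))\<^sup>2 < d + inverse (real (Suc n))"
    by metis
  have close: "(norm (s m - s n))\<^sup>2 \<le> 2 * inverse (real (Suc m)) + 2 * inverse (real (Suc n))" for m n
  proof -
    have mid: "(1/2) *\<^sub>R (s m + s n) \<in> W"
      using subspace_scaleR[OF W(1) subspace_add[OF W(1) s(1) s(1)]] .
    have "(h - s m) + (h - s n) = 2 *\<^sub>R (h - (1/2) *\<^sub>R (s m + s n))"
      by (simp add: scaleR_2 scaleR_diff_right flip: scaleR_add_right)
    then have "(norm ((h - s m) + (h - s n)))\<^sup>2 = 4 * (norm (h - (1/2) *\<^sub>R (s m + s n)))\<^sup>2"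
      by (simp only: norm_scaleR power_mult_distrib) simp
    moreover have "norm ((h - s m) - (h - s n)) = norm (s m - s n)"
      by (simp add: norm_minus_commute)
    ultimately show ?thesis
      using parallelogram[of "h - s m" "h - s n"] lower[OF mid] s(2)[of m] s(2)[of n] by simp
  qed
  have "Cauchy s"
  proof (rule CauchyI)
    fix \<epsilon> :: real assume "0 < \<epsilon>"
    then obtain N where N: "inverse (real (Suc N)) < \<epsilon>\<^sup>2 / 4"
      using reals_Archimedean[of "\<epsilon>\<^sup>2 / 4"] by auto
    have "norm (s m - s n) < \<epsilon>" if "N \<le> m" "N \<le> n" for m n
    proof (rule power2_less_imp_less)
      have "inverse (real (Suc k)) \<le> inverse (real (Suc N))" if "N \<le> k" for k
        using that by (simp add: field_simps)
      from this[OF that(1)] this[OF that(2)] show "(norm (s m - s n))\<^sup>2 < \<epsilon>\<^sup>2"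
        using close[of m n] N by linarith
    qed (use \<open>0 < \<epsilon>\<close> in simp)
    then show "\<exists>M. \<forall>m\<ge>M. \<forall>n\<ge>M. norm (s m - s n) < \<epsilon>"
      by blast
  qed
  then obtain p where p: "s \<longlonglongrightarrow> p"
    using Cauchy_convergent convergentD by blast
  have "(\<lambda>n. (norm (h - s n))\<^sup>2) \<longlonglongrightarrow> (norm (h - p))\<^sup>2"
    by (intro tendsto_intros p)
  moreover have "(\<lambda>n. d + inverse (real (Suc n))) \<longlonglongrightarrow> d + 0"
    by (intro tendsto_add tendsto_const LIMSEQ_inverse_real_of_nat)
  ultimately have "(norm (h - p))\<^sup>2 \<le> d + 0"
    by (rule LIMSEQ_le) (use s(2) in \<open>auto intro: less_imp_le\<close>)
  moreover have "p \<in> W"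
    using closed_sequentially[OF W(2) s(1) p] .
  ultimately show ?thesis
    using order_trans[OF _ lower] by (metis add.right_neutral)
qed

lemma orthogonal_projection_exists:
  assumes W: "subspace W" "closed W"
  shows "\<exists>p\<in>W. \<forall>w\<in>W. ip (h - p) w = 0"
proof -
  obtain p where p: "p \<in> W" "\<And>w. w \<in> W \<Longrightarrow> (norm (h - p))\<^sup>2 \<le> (norm (h - w))\<^sup>2"
    using nearest_point_exists[OF W] by blast
  have "ip (h - p) w = 0" if w: "w \<in> W" for w
  proof (cases "w = 0")
    case False
    define c where "c = ip (h - p) w / of_real ((norm w)\<^sup>2)"
    have "p + smul c w \<in> W"
      using W(1) p(1) w by (intro subspace_add subspace_scale)
    \<comment> \<open>If \<open>h - p\<close> were not orthogonal to \<open>w\<close>, moving from \<open>p\<close> to \<open>p + c w\<close> would bring it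
      closer to \<open>h\<close>.\<close>
    then have "(norm (h - p))\<^sup>2 \<le> (norm (h - p - smul c w))\<^sup>2"
      using p(2) by (simp add: diff_diff_add)
    also have "\<dots> = (norm (h - p))\<^sup>2 - (norm (ip (h - p) w))\<^sup>2 / (norm w)\<^sup>2"
      unfolding c_def by (rule norm_diff_line_projection[OF False])
    finally show ?thesis
      using False by (simp add: divide_le_0_iff)
  next
    case True
    then show ?thesis
      by (simp add: ip_eq_0_commute)
  qed
  with p(1) show ?thesis
    by blast
qed

lemma orth_proj:
  assumes W: "subspace W" "closed W"
  shows "orth_proj ip W h \<in> W" and "w \<in> W \<Longrightarrow> ip (h - orth_proj ip W h) w = 0"
proof -
  obtain p where p: "p \<in> W" "\<forall>w\<in>W. ip (h - p) w = 0"
    using orthogonal_projection_exists[OF W] by blast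
  have "q = p" if q: "q \<in> W" "\<forall>w\<in>W. ip (h - q) w = 0" for q
  proof -
    have "q - p \<in> W"
      using W(1) q(1) p(1) by (rule subspace_diff)
    then have "ip (h - p) (q - p) - ip (h - q) (q - p) = 0"
      using p(2) q(2) by simp
    then have "ip (q - p) (q - p) = 0"
      by (simp flip: ip_diff_left)
    then show ?thesis
      by (simp add: ip_norm)
  qed
  then have "orth_proj ip W h = p"
    unfolding orth_proj_def using p by (intro the_equality) blast+
  with p show "orth_proj ip W h \<in> W" and "w \<in> W \<Longrightarrow> ip (h - orth_proj ip W h) w = 0"
    by auto
qed

lemma ip_orth_proj:
  assumes "subspace W" "closed W" "w \<in> W"
  shows "ip (orth_proj ip W h) w = ip h w"
  using orth_proj(2)[OF assms, of h] by (simp add: ip_diff_left)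

section \<open>Orthonormal bases are Parseval frames\<close>

definition fourier_sum :: "('l \<Rightarrow> 'a) \<Rightarrow> 'l set \<Rightarrow> 'a \<Rightarrow> 'a" where
  "fourier_sum e F h = (\<Sum>k\<in>F. smul (ip h (e k)) (e k))"

context
  fixes K :: "'l set" and e :: "'l \<Rightarrow> 'a"
  assumes orthonormal: "\<And>j k. j \<in> K \<Longrightarrow> k \<in> K \<Longrightarrow> ip (e j) (e k) = (if j = k then 1 else 0)"
begin

lemma fourier_residual_orthogonal:
  assumes F: "finite F" "F \<subseteq> K" and s: "s \<in> span (e ` F)"
  shows "ip (h - fourier_sum e F h) s = 0"
proof -
  have "ip s (h - fourier_sum e F h) = 0"
    using s
  proof (induction rule: span_induct_alt)
    case (step c x y)
    then obtain k where k: "k \<in> F" "x = e k"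
      by blast
    have "ip (fourier_sum e F h) (e k) = (\<Sum>j\<in>F. if j = k then ip h (e j) else 0)"
      unfolding fourier_sum_def ip_sum_left ip_smul_left
    proof (rule sum.cong)
      fix j assume "j \<in> F"
      then have "j \<in> K" "k \<in> K"
        using F(2) k(1) by auto
      then show "ip h (e j) * ip (e j) (e k) = (if j = k then ip h (e j) else 0)"
        by (simp add: orthonormal)
    qed simp
    also have "\<dots> = ip h (e k)"
      using F(1) k(1) by simp
    finally have "ip (h - fourier_sum e F h) x = 0"
      by (simp add: k(2) ip_diff_left)
    then show ?case
      using step.IH by (simp add: ip_add_left ip_smul_left ip_eq_0_commute)
  qed simp
  then show ?thesis
    by (rule ip_eq_0_commute)
qed

lemma fourier_sum_in_span: "fourier_sum e F h \<in> span (e ` F)"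
  unfolding fourier_sum_def by (intro span_sum span_scale span_base) auto

lemma norm_fourier_residual:
  assumes F: "finite F" "F \<subseteq> K"
  shows "(norm (h - fourier_sum e F h))\<^sup>2 = (norm h)\<^sup>2 - (\<Sum>k\<in>F. (norm (ip h (e k)))\<^sup>2)"
proof -
  let ?P = "fourier_sum e F h"
  have orth: "ip (h - ?P) ?P = 0"
    by (rule fourier_residual_orthogonal[OF F fourier_sum_in_span])
  have "(of_real ((norm ?P)\<^sup>2) :: 'k) = ip ?P h"
    using ip_eq_0_commute[OF orth] by (simp add: ip_norm[symmetric] ip_diff_right del: of_real_power)
  also have "\<dots> = (\<Sum>k\<in>F. of_real ((norm (ip h (e k)))\<^sup>2))"
    unfolding fourier_sum_def ip_sum_left ip_smul_left
    by (rule sum.cong) (simp_all add: ip_commute[of "e _" h] mult_kconj of_real_def)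
  finally have "(of_real ((norm ?P)\<^sup>2) :: 'k) = of_real (\<Sum>k\<in>F. (norm (ip h (e k)))\<^sup>2)"
    by simp
  then have "(norm ?P)\<^sup>2 = (\<Sum>k\<in>F. (norm (ip h (e k)))\<^sup>2)"
    unfolding of_real_eq_iff .
  then show ?thesis
    using norm_add_orthogonal[OF orth] by simp
qed

lemma bessel:
  assumes "finite F" "F \<subseteq> K"
  shows "(\<Sum>k\<in>F. (norm (ip h (e k)))\<^sup>2) \<le> (norm h)\<^sup>2"
  using norm_fourier_residual[OF assms, of h] zero_le_power2[of "norm (h - fourier_sum e F h)"]
  by linarith

lemma bessel_summable: "(\<lambda>k. (norm (ip h (e k)))\<^sup>2) summable_on K"
  using bessel by (intro nonneg_bdd_above_summable_on bdd_aboveI2[where M = "(norm h)\<^sup>2"]) auto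

text \<open>
  A Fourier sum is the best approximation to \<open>h\<close> from the span of its basis vectors, so density of
  the span makes the defect in Bessel's inequality arbitrarily small.
\<close>

lemma parseval:
  assumes "h \<in> closed_span smul (e ` K)"
  shows "(\<Sum>\<^sub>\<infinity>k\<in>K. (norm (ip h (e k)))\<^sup>2) = (norm h)\<^sup>2"
proof (rule antisym)
  show "(\<Sum>\<^sub>\<infinity>k\<in>K. (norm (ip h (e k)))\<^sup>2) \<le> (norm h)\<^sup>2"
    using bessel by (intro infsum_le_finite_sums bessel_summable)
next
  show "(norm h)\<^sup>2 \<le> (\<Sum>\<^sub>\<infinity>k\<in>K. (norm (ip h (e k)))\<^sup>2)"
  proof (rule field_le_epsilon)
    fix \<epsilon> :: real assume "0 < \<epsilon>"
    then have "0 < sqrt \<epsilon>"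
      by simp
    then obtain s where s: "s \<in> span (e ` K)" "dist s h < sqrt \<epsilon>"
      using assms unfolding closed_span_def closure_approachable by blast
    obtain T r where T: "finite T" "T \<subseteq> e ` K" "s = (\<Sum>a\<in>T. smul (r a) a)"
      using s(1) unfolding span_explicit by blast
    obtain F where F: "F \<subseteq> K" "finite F" "T = e ` F"
      using finite_subset_image[OF T(1,2)] by blast
    have "s \<in> span (e ` F)"
      unfolding T(3) F(3) by (intro span_sum span_scale span_base)
    then have "fourier_sum e F h - s \<in> span (e ` F)"
      by (intro span_diff fourier_sum_in_span)
    from norm_add_orthogonal[OF fourier_residual_orthogonal[OF F(2,1) this, of h]]
    have "(norm (h - fourier_sum e F h))\<^sup>2 \<le> (norm (h - s))\<^sup>2"
      by simp
    also have "\<dots> \<le> (sqrt \<epsilon>)\<^sup>2"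
      using s(2) by (intro power_mono) (simp_all add: dist_norm norm_minus_commute)
    finally have "(norm h)\<^sup>2 \<le> (\<Sum>k\<in>F. (norm (ip h (e k)))\<^sup>2) + \<epsilon>"
      using norm_fourier_residual[OF F(2,1), of h] \<open>0 < \<epsilon>\<close> by simp
    moreover have "(\<Sum>k\<in>F. (norm (ip h (e k)))\<^sup>2) \<le> (\<Sum>\<^sub>\<infinity>k\<in>K. (norm (ip h (e k)))\<^sup>2)"
      using F by (intro finite_sum_le_infsum bessel_summable) auto
    ultimately show "(norm h)\<^sup>2 \<le> (\<Sum>\<^sub>\<infinity>k\<in>K. (norm (ip h (e k)))\<^sup>2) + \<epsilon>"
      by linarith
  qed
qed

end

lemma orthonormal_basis_parseval_frame:
  assumes "orthonormal_basis smul ip W K e"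
  shows "frame_with_bounds ip W K e 1 1"
proof -
  have on: "\<And>j k. j \<in> K \<Longrightarrow> k \<in> K \<Longrightarrow> ip (e j) (e k) = (if j = k then 1 else 0)"
    and W: "W = closed_span smul (e ` K)"
    using assms unfolding orthonormal_basis_def by auto
  have "e ` K \<subseteq> W"
    unfolding W closed_span_def using span_superset closure_subset by blast
  then show ?thesis
    unfolding frame_with_bounds_def
    using bessel_summable[OF on] parseval[OF on] W by auto
qed

section \<open>Gluing local frames\<close>

text \<open>
  A frame for \<open>W\<close> only controls vectors of \<open>W\<close>; the bounds reach arbitrary \<open>h\<close> because the
  coefficients of \<open>h\<close> and of its projection onto \<open>W\<close> coincide.
\<close>

lemma local_frame_projection_bounds:
  assumes W: "subspace W" "closed W" and g: "frame_with_bounds ip W J g \<alpha> \<beta>"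
    and bounds: "a \<le> \<alpha>" "\<beta> \<le> b"
  shows "(\<lambda>j. (norm (ip h (c *\<^sub>R g j)))\<^sup>2) summable_on J" (is ?summable)
    and "a * (c\<^sup>2 * (norm (orth_proj ip W h))\<^sup>2) \<le> (\<Sum>\<^sub>\<infinity>j\<in>J. (norm (ip h (c *\<^sub>R g j)))\<^sup>2)" (is ?lower)
    and "(\<Sum>\<^sub>\<infinity>j\<in>J. (norm (ip h (c *\<^sub>R g j)))\<^sup>2) \<le> b * (c\<^sup>2 * (norm (orth_proj ip W h))\<^sup>2)" (is ?upper)
proof -
  define p where "p = orth_proj ip W h"
  let ?S = "\<Sum>\<^sub>\<infinity>j\<in>J. (norm (ip p (g j)))\<^sup>2"
  have p: "p \<in> W"
    unfolding p_def by (rule orth_proj(1)[OF W])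
  have gW: "g j \<in> W" if "j \<in> J" for j
    using g that unfolding frame_with_bounds_def by blast
  have S: "(\<lambda>j. (norm (ip p (g j)))\<^sup>2) summable_on J"
    "\<alpha> * (norm p)\<^sup>2 \<le> ?S" "?S \<le> \<beta> * (norm p)\<^sup>2"
    using g p unfolding frame_with_bounds_def by blast+
  have coeff: "(norm (ip h (c *\<^sub>R g j)))\<^sup>2 = c\<^sup>2 * (norm (ip p (g j)))\<^sup>2" if "j \<in> J" for j
    unfolding p_def ip_orth_proj[OF W gW[OF that]] norm_ip_scaleR_right
    by (simp add: power_mult_distrib)
  show ?summable
    using summable_on_cmult_right[OF S(1), of "c\<^sup>2"] by (simp add: coeff cong: summable_on_cong)
  have eq: "(\<Sum>\<^sub>\<infinity>j\<in>J. (norm (ip h (c *\<^sub>R g j)))\<^sup>2) = c\<^sup>2 * ?S"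
    using infsum_cmult_right[of "c\<^sup>2", OF S(1)] by (simp add: coeff cong: infsum_cong)
  have "a * (norm p)\<^sup>2 \<le> ?S" "?S \<le> b * (norm p)\<^sup>2"
    using S(2,3) bounds mult_right_mono[of _ _ "(norm p)\<^sup>2"] by fastforce+
  then have "c\<^sup>2 * (a * (norm p)\<^sup>2) \<le> c\<^sup>2 * ?S" "c\<^sup>2 * ?S \<le> c\<^sup>2 * (b * (norm p)\<^sup>2)"
    by (intro mult_left_mono; simp)+
  then show ?lower ?upper
    unfolding eq p_def by (simp_all add: mult.left_commute)
qed

end

lemma summable_on_Sigma_iff_nonneg:
  fixes F :: "'i \<times> 'j \<Rightarrow> real"
  assumes inner: "\<And>i. i \<in> I \<Longrightarrow> (\<lambda>j. F (i, j)) summable_on J i"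
    and nonneg: "\<And>i j. i \<in> I \<Longrightarrow> j \<in> J i \<Longrightarrow> 0 \<le> F (i, j)"
  shows "F summable_on Sigma I J \<longleftrightarrow> (\<lambda>i. \<Sum>\<^sub>\<infinity>j\<in>J i. F (i, j)) summable_on I"
  using summable_on_SigmaD[OF _ inner] summable_on_SigmaI[OF has_sum_infsum[OF inner] _ nonneg]
  by blast

lemma summable_on_real_sandwich:
  fixes q S :: "'i \<Rightarrow> real"
  assumes a: "0 < a" and q: "\<And>i. i \<in> I \<Longrightarrow> 0 \<le> q i"
    and lower: "\<And>i. i \<in> I \<Longrightarrow> a * q i \<le> S i" and upper: "\<And>i. i \<in> I \<Longrightarrow> S i \<le> b * q i"
  shows "S summable_on I \<longleftrightarrow> q summable_on I"
    and "q summable_on I \<Longrightarrow> a * infsum q I \<le> infsum S I"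
    and "q summable_on I \<Longrightarrow> infsum S I \<le> b * infsum q I"
proof -
  have S: "0 \<le> S i" if "i \<in> I" for i
    using lower[OF that] q[OF that] a by (meson mult_nonneg_nonneg less_imp_le order_trans)
  have to_S: "S summable_on I" if "q summable_on I"
    using summable_on_cmult_right[OF that] upper S by (rule summable_on_comparison_test)
  have "q summable_on I" if "S summable_on I"
  proof -
    have "(\<lambda>i. a * q i) summable_on I"
      using that lower by (rule summable_on_comparison_test) (simp_all add: a q less_imp_le)
    then show ?thesis
      using a by (simp add: summable_on_cmult_right')
  qed
  with to_S show "S summable_on I \<longleftrightarrow> q summable_on I"
    by blast
  assume sum: "q summable_on I"
  show "a * infsum q I \<le> infsum S I"
    unfolding infsum_cmult_right[OF sum, symmetric]
    by (intro infsum_mono summable_on_cmult_right sum to_S lower)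
  show "infsum S I \<le> b * infsum q I"
    unfolding infsum_cmult_right[OF sum, symmetric]
    by (intro infsum_mono summable_on_cmult_right sum to_S upper)
qed

text \<open>
  Both inequalities needed in each direction are instances of
  \<open>a * \<Sigma> \<le> S \<le> b * \<Sigma>\<close>, where \<open>\<Sigma>\<close> is the weighted sum of squared projections of \<open>h\<close> and \<open>S\<close> the
  sum of squared coefficients with respect to the glued family: a glued frame with bounds \<open>C, D\<close>
  gives subspace bounds \<open>C / b, D / a\<close>, and subspace bounds \<open>C, D\<close> give frame bounds
  \<open>a * C, b * D\<close>.
\<close>

lemma (in hilbert_space) glued_frame_iff_frame_of_subspaces:
  assumes v: "\<And>i. i \<in> I \<Longrightarrow> 0 < v i"
    and W: "\<And>i. i \<in> I \<Longrightarrow> subspace (W i)" "\<And>i. i \<in> I \<Longrightarrow> closed (W i)"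
    and g: "\<And>i. i \<in> I \<Longrightarrow> frame_with_bounds ip (W i) (J i) (g i) (\<alpha> i) (\<beta> i)"
    and bounds: "\<And>i. i \<in> I \<Longrightarrow> a \<le> \<alpha> i" "\<And>i. i \<in> I \<Longrightarrow> \<beta> i \<le> b"
    and ab: "0 < a" "a \<le> b"
  shows "is_frame ip (Sigma I J) (\<lambda>(i, j). v i *\<^sub>R g i j) \<longleftrightarrow> frame_of_subspaces smul ip I W v"
proof -
  define q where "q = (\<lambda>h i. (v i)\<^sup>2 * (norm (orth_proj ip (W i) h))\<^sup>2)"
  define F where "F = (\<lambda>h k. (norm (ip h (case k of (i, j) \<Rightarrow> v i *\<^sub>R g i j)))\<^sup>2)"
  note loc = local_frame_projection_bounds[OF W g bounds]
  have inner: "(\<lambda>j. F h (i, j)) summable_on J i" if "i \<in> I" for h i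
    using loc(1)[OF that that that that that] by (simp add: F_def)
  have S: "a * q h i \<le> (\<Sum>\<^sub>\<infinity>j\<in>J i. F h (i, j))" "(\<Sum>\<^sub>\<infinity>j\<in>J i. F h (i, j)) \<le> b * q h i"
    if "i \<in> I" for h i
    using loc(2,3)[OF that that that that that] by (simp_all add: F_def q_def)
  have q: "0 \<le> q h i" for h i
    by (simp add: q_def)
  note sandwich = summable_on_real_sandwich[where q = "q h" for h, OF ab(1) q S]
  have summable: "F h summable_on Sigma I J \<longleftrightarrow> q h summable_on I" for h
    using summable_on_Sigma_iff_nonneg[of I "F h" J, OF inner] sandwich(1)[of I h]
    by (auto simp: F_def)
  have sums: "a * infsum (q h) I \<le> infsum (F h) (Sigma I J)"
    "infsum (F h) (Sigma I J) \<le> b * infsum (q h) I" if "q h summable_on I" for h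
    using sandwich(2,3)[OF _ _ that] that summable[of h]
    by (simp_all flip: infsum_Sigma_banach)
  have b: "0 < b"
    using ab by linarith
  show ?thesis
  proof
    assume "is_frame ip (Sigma I J) (\<lambda>(i, j). v i *\<^sub>R g i j)"
    then obtain C D where CD: "0 < C" "C \<le> D"
      and fr: "\<And>h. F h summable_on Sigma I J" "\<And>h. C * (norm h)\<^sup>2 \<le> infsum (F h) (Sigma I J)"
        "\<And>h. infsum (F h) (Sigma I J) \<le> D * (norm h)\<^sup>2"
      unfolding is_frame_def frame_with_bounds_def F_def by auto
    have qs: "q h summable_on I" for h
      using fr(1) summable by blast
    have "C / b * (norm h)\<^sup>2 \<le> infsum (q h) I" for h
      using order_trans[OF fr(2) sums(2)[OF qs]] b by (simp add: field_simps)
    moreover have "infsum (q h) I \<le> D / a * (norm h)\<^sup>2" for h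
      using order_trans[OF sums(1)[OF qs] fr(3)] ab(1) by (simp add: field_simps)
    moreover have "0 < C / b" "C / b \<le> D / a"
      using CD ab b by (auto intro: frac_le)
    ultimately show "frame_of_subspaces smul ip I W v"
      unfolding frame_of_subspaces_def using v W qs unfolding q_def by blast
  next
    assume "frame_of_subspaces smul ip I W v"
    then obtain C D where CD: "0 < C" "C \<le> D"
      and fr: "\<And>h. q h summable_on I" "\<And>h. C * (norm h)\<^sup>2 \<le> infsum (q h) I"
        "\<And>h. infsum (q h) I \<le> D * (norm h)\<^sup>2"
      unfolding frame_of_subspaces_def q_def by blast
    have "a * C * (norm h)\<^sup>2 \<le> infsum (F h) (Sigma I J)" for h
      using order_trans[OF mult_left_mono[OF fr(2)] sums(1)[OF fr(1)]] ab by (simp add: mult.assoc)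
    moreover have "infsum (F h) (Sigma I J) \<le> b * D * (norm h)\<^sup>2" for h
      using order_trans[OF sums(2)[OF fr(1)] mult_left_mono[OF fr(3)]] b by (simp add: mult.assoc)
    moreover have "0 < a * C" "a * C \<le> b * D"
      using CD ab b by (auto intro: mult_mono)
    moreover have "F h summable_on Sigma I J" for h
      using fr(1) summable by blast
    ultimately show "is_frame ip (Sigma I J) (\<lambda>(i, j). v i *\<^sub>R g i j)"
      unfolding is_frame_def frame_with_bounds_def F_def by blast
  qed
qed

lemma ereal_INF_SUP_real_bounds:
  fixes A B :: "'i \<Rightarrow> real"
  assumes inf: "0 < (INF i\<in>I. ereal (A i))" and le: "(INF i\<in>I. ereal (A i)) \<le> (SUP i\<in>I. ereal (B i))"
    and sup: "(SUP i\<in>I. ereal (B i)) < \<infinity>"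
  obtains a b where "0 < a" "a \<le> b" "\<And>i. i \<in> I \<Longrightarrow> a \<le> A i" "\<And>i. i \<in> I \<Longrightarrow> B i \<le> b"
proof -
  obtain a where a: "(INF i\<in>I. ereal (A i)) = ereal a"
    using inf le sup by (cases "INF i\<in>I. ereal (A i)") auto
  obtain b where b: "(SUP i\<in>I. ereal (B i)) = ereal b"
    using inf le sup by (cases "SUP i\<in>I. ereal (B i)") auto
  show thesis
  proof
    show "0 < a" "a \<le> b"
      using inf le unfolding a b by simp_all
    show "a \<le> A i" if "i \<in> I" for i
      using INF_lower[OF that, of "\<lambda>i. ereal (A i)"] unfolding a by simp
    show "B i \<le> b" if "i \<in> I" for i
      using SUP_upper[OF that, of "\<lambda>i. ereal (B i)"] unfolding b by simp
  qed
qed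

section \<open>Frames, orthonormal bases and frames of subspaces\<close>

theorem theorem3p2:
  fixes smul :: "'k::rc_scalar \<Rightarrow> 'a::banach \<Rightarrow> 'a"
    and ip :: "'a \<Rightarrow> 'a \<Rightarrow> 'k"
    and I :: "'i set"
    and J :: "'i \<Rightarrow> 'j set"
    and K :: "'i \<Rightarrow> 'l set"
    and v A B :: "'i \<Rightarrow> real"
    and f :: "'i \<Rightarrow> 'j \<Rightarrow> 'a"
    and e :: "'i \<Rightarrow> 'l \<Rightarrow> 'a"
    and W :: "'i \<Rightarrow> 'a set"
  assumes "hilbert_space smul ip"
    and "separable_space (euclidean :: 'a topology)"
    and "\<And>i. i \<in> I \<Longrightarrow> 0 < v i"
    and "\<And>i. i \<in> I \<Longrightarrow> frame_sequence smul ip (J i) (f i) (A i) (B i)"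
    and "\<And>i. i \<in> I \<Longrightarrow> W i = closed_span smul (f i ` J i)"
    and "\<And>i. i \<in> I \<Longrightarrow> orthonormal_basis smul ip (W i) (K i) (e i)"
    and "0 < (INF i\<in>I. ereal (A i))"
    and "(INF i\<in>I. ereal (A i)) \<le> (SUP i\<in>I. ereal (B i))"
    and "(SUP i\<in>I. ereal (B i)) < \<infinity>"
  shows "(is_frame ip (Sigma I J) (\<lambda>(i, j). v i *\<^sub>R f i j) \<longleftrightarrow>
            is_frame ip (Sigma I K) (\<lambda>(i, j). v i *\<^sub>R e i j))
       \<and> (is_frame ip (Sigma I K) (\<lambda>(i, j). v i *\<^sub>R e i j) \<longleftrightarrow>
            frame_of_subspaces smul ip I W v)"
proof -
  interpret hilbert_space smul ip
    by fact
  obtain a b where ab: "0 < a" "a \<le> b" "\<And>i. i \<in> I \<Longrightarrow> a \<le> A i" "\<And>i. i \<in> I \<Longrightarrow> B i \<le> b"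
    using ereal_INF_SUP_real_bounds[OF assms(7-9)] by metis
  have W: "subspace (W i)" "closed (W i)" if "i \<in> I" for i
    using assms(5)[OF that] subspace_closed_span closed_closed_span by simp_all
  have f: "frame_with_bounds ip (W i) (J i) (f i) (A i) (B i)" if "i \<in> I" for i
    using assms(4)[OF that] unfolding frame_sequence_def assms(5)[OF that] .
  have e: "frame_with_bounds ip (W i) (K i) (e i) 1 1" if "i \<in> I" for i
    using assms(6)[OF that] by (rule orthonormal_basis_parseval_frame)
  have "is_frame ip (Sigma I J) (\<lambda>(i, j). v i *\<^sub>R f i j) \<longleftrightarrow> frame_of_subspaces smul ip I W v"
    using assms(3) W f ab(3,4) ab(1,2) by (rule glued_frame_iff_frame_of_subspaces)
  moreover have "is_frame ip (Sigma I K) (\<lambda>(i, j). v i *\<^sub>R e i j) \<longleftrightarrow> frame_of_subspaces smul ip I W v"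
    by (rule glued_frame_iff_frame_of_subspaces[OF assms(3) W e, where a = 1 and b = 1]) simp_all
  ultimately show ?thesis
    by blast
qed

end
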